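(* There exists an infinite family of graphs such that for each graph $G$ in the family, $D_{\Gamma(G)+1}(G)$ is not connected.
   Context: All graphs are finite, simple and undirected. A set $S\subseteq V(G)$ is a dominating set of $G$ if every vertex of $V(G)\setminus S$ is adjacent to a vertex of $S$; $\Gamma(G)$ denotes the maximum cardinality of a minimal (with respect to inclusion) dominating set of $G$. For a positive integer $k$, the $k$-dominating graph $D_k(G)$ has as vertices the dominating sets of $G$ of cardinality at most $k$, two such sets being adjacent iff their symmetric difference consists of exactly one vertex of $G$. *)

theory Defs
  imports "Graph_Theory.Graph_Theory"
begin

text \<open>
  A finite simple undirected graph is a \<^term>\<open>G :: 'a pair_pre_digraph\<close> with
  \<^prop>\<open>pair_graph G\<close>: the edge \<open>uv\<close> is represented by the two arcs
  \<open>(u, v)\<close> and \<open>(v, u)\<close>.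
\<close>

definition dominating_set :: "'a pair_pre_digraph \<Rightarrow> 'a set \<Rightarrow> bool" where
  "dominating_set G S \<longleftrightarrow>
     S \<subseteq> pverts G \<and> (\<forall>v \<in> pverts G - S. \<exists>u \<in> S. (u, v) \<in> parcs G)"

definition minimal_dominating_set :: "'a pair_pre_digraph \<Rightarrow> 'a set \<Rightarrow> bool" where
  "minimal_dominating_set G S \<longleftrightarrow>
     dominating_set G S \<and> (\<forall>T. T \<subset> S \<longrightarrow> \<not> dominating_set G T)"

definition upper_domination_number :: "'a pair_pre_digraph \<Rightarrow> nat" where
  "upper_domination_number G = Max (card ` {S. minimal_dominating_set G S})"

definition dominating_graph :: "nat \<Rightarrow> 'a pair_pre_digraph \<Rightarrow> 'a set pair_pre_digraph" where
  "dominating_graph k G =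
     (let V = {S. dominating_set G S \<and> card S \<le> k}
      in \<lparr> pverts = V,
           parcs = {(S, T). S \<in> V \<and> T \<in> V \<and> card ((S - T) \<union> (T - S)) = 1} \<rparr>)"

text \<open>
  On finite graphs the maximum above ranges over a finite nonempty set, and the
  dominating graph is again a finite simple graph.
\<close>

lemma finite_minimal_dominating_sets:
  assumes "finite (pverts G)"
  shows "finite {S. minimal_dominating_set G S}"
  by (rule finite_subset[of _ "Pow (pverts G)"])
    (use assms in \<open>auto simp: minimal_dominating_set_def dominating_set_def\<close>)

lemma ex_minimal_dominating_set:
  assumes "finite (pverts G)"
  shows "\<exists>S. minimal_dominating_set G S"
proof -
  have "finite {S. dominating_set G S}"
    by (rule finite_subset[of _ "Pow (pverts G)"]) (use assms in \<open>auto simp: dominating_set_def\<close>)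
  moreover have "pverts G \<in> {S. dominating_set G S}"
    by (simp add: dominating_set_def)
  ultimately obtain S where "S \<in> {S. dominating_set G S}"
      "\<forall>T \<in> {S. dominating_set G S}. T \<subseteq> S \<longrightarrow> S = T"
    using finite_has_minimal[of "{S. dominating_set G S}"] by blast
  then show ?thesis
    unfolding minimal_dominating_set_def by blast
qed

lemma pair_graph_dominating_graph:
  assumes "finite (pverts G)"
  shows "pair_graph (dominating_graph k G)"
proof -
  let ?D = "dominating_graph k G"
  have fin: "finite (pverts ?D)"
    by (rule finite_subset[of _ "Pow (pverts G)"])
      (use assms in \<open>auto simp: dominating_graph_def Let_def dominating_set_def\<close>)
  have "finite (parcs ?D)"
    by (rule finite_subset[of _ "pverts ?D \<times> pverts ?D"])
      (use fin in \<open>auto simp: dominating_graph_def Let_def\<close>)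
  with fin show ?thesis
    by unfold_locales
      (auto simp: dominating_graph_def Let_def symmetric_def sym_def Un_commute)
qed

end

theory Submission
  imports Defs
begin

text \<open>
  Take \<open>n + 1\<close> disjoint cliques \<open>B\<^sub>0, \<dots>, B\<^sub>n\<close> of size \<open>n \<ge> 3\<close> and join the \<open>j\<close>-th vertex of
  \<open>B\<^sub>0\<close> to the \<open>j\<close>-th vertex of every other clique. A dominating set contains \<open>B\<^sub>0\<close> or meets each of
  \<open>B\<^sub>1, \<dots>, B\<^sub>n\<close>: a vertex of an unmet \<open>B\<^sub>i\<close> can only be dominated from \<open>B\<^sub>0\<close>. Both kinds are
  closed under supersets, so a path from one kind to the other passes through a set of both kinds,
  which has at least \<open>2 n\<close> elements. On the other hand \<open>\<Gamma> \<le> 2 n - 2\<close>. The critical case is a minimal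
  dominating set disjoint from \<open>B\<^sub>0\<close>: it is a minimal edge cover of \<open>K\<^bsub>n,n\<^esub>\<close> (cliques against
  positions), a spanning star forest with at least two stars.
\<close>

text \<open>Vertex \<open>u\<close> is the vertex at position \<open>u mod n\<close> of \<open>B\<^sub>i\<close> with \<open>i = u div n\<close>; in particular \<open>B\<^sub>0 = {..<n}\<close>.\<close>

definition linked_cliques :: "nat \<Rightarrow> nat pair_pre_digraph" where
  "linked_cliques n =
    \<lparr> pverts = {..<n * Suc n},
      parcs = {(u, v). u < n * Suc n \<and> v < n * Suc n \<and> u \<noteq> v \<and>
        (u div n = v div n \<or> u mod n = v mod n \<and> (u div n = 0 \<or> v div n = 0))} \<rparr>"

section \<open>Well-formedness and order of the graphs\<close>

lemma pair_graph_linked_cliques: "pair_graph (linked_cliques n)"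
proof -
  have "finite (parcs (linked_cliques n))"
    by (rule finite_subset[of _ "{..<n * Suc n} \<times> {..<n * Suc n}"])
      (auto simp: linked_cliques_def)
  then show ?thesis
    by unfold_locales (auto simp: linked_cliques_def symmetric_def sym_def)
qed

lemma card_verts_linked_cliques: "card (pverts (linked_cliques n)) = n * Suc n"
  by (simp add: linked_cliques_def)

lemma strict_mono_mult_Suc: "strict_mono (\<lambda>n::nat. n * Suc n)"
  by (auto simp: strict_mono_Suc_iff)

lemma digraph_iso_card_verts:
  assumes "digraph_iso G H"
  shows "card (verts G) = card (verts H)"
  using assms
  by (auto simp: digraph_iso_def pre_digraph.digraph_isomorphism_def card_image)

section \<open>Dominating sets of the linked cliques\<close>

lemma div_le_if_less_mult_Suc: "(u::nat) < n * Suc n \<Longrightarrow> u div n \<le> n"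
  by (metis less_Suc_eq_le less_mult_imp_div_less mult.commute)

lemma mult_add_less_mult_Suc:
  fixes i j n :: nat
  assumes "i \<le> n" "j < n"
  shows "i * n + j < n * Suc n"
proof -
  have "i * n \<le> n * n"
    using assms(1) by (rule mult_le_mono1)
  then have "i * n + j < n * n + n"
    using assms(2) by (rule add_le_less_mono)
  then show ?thesis
    by simp
qed

text \<open>The vertex at position \<open>j\<close> of an unmet \<open>B\<^sub>i\<close> has
  \<open>j\<close> as its only neighbour outside \<open>B\<^sub>i\<close>, so every \<open>j\<close>
  in \<open>B\<^sub>0\<close> is forced into \<open>S\<close>.\<close>

lemma dominating_linked_cliques_cases:
  assumes dom: "dominating_set (linked_cliques n) S"
  shows "{..<n} \<subseteq> S \<or> {1..n} \<subseteq> (\<lambda>u. u div n) ` S"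
proof (rule disjCI)
  assume "\<not> {1..n} \<subseteq> (\<lambda>u. u div n) ` S"
  then obtain i where i: "1 \<le> i" "i \<le> n" "i \<notin> (\<lambda>u. u div n) ` S"
    by (meson atLeastAtMost_iff subsetI)
  show "{..<n} \<subseteq> S"
  proof
    fix j assume "j \<in> {..<n}"
    then have j: "j < n"
      by simp
    let ?w = "i * n + j"
    have "?w div n = i" "?w mod n = j"
      using j by auto
    moreover from this have "?w \<notin> S"
      using i by (metis imageI)
    moreover have "?w \<in> pverts (linked_cliques n)"
      using mult_add_less_mult_Suc[OF i(2) j] by (simp add: linked_cliques_def)
    ultimately obtain u where "u \<in> S" "(u, ?w) \<in> parcs (linked_cliques n)"
      using dom unfolding dominating_set_def by blast
    then have "u \<in> S" "u mod n = j" "u div n = 0"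
      using i \<open>?w div n = i\<close> \<open>?w mod n = j\<close> by (auto simp: linked_cliques_def)
    then show "j \<in> S"
      by (metis add.left_neutral div_mult_mod_eq mult_zero_left)
  qed
qed

text \<open>Each \<open>j\<close> in \<open>B\<^sub>0\<close> must be dominated from another clique,
  where its only neighbours sit at position \<open>j\<close>. Cliques are the columns, positions the
  rows.\<close>

lemma dominating_linked_cliques_rows:
  assumes dom: "dominating_set (linked_cliques n) S" and disj: "S \<inter> {..<n} = {}"
  shows "{..<n} \<subseteq> (\<lambda>u. u mod n) ` S"
proof
  fix j assume j: "j \<in> {..<n}"
  then have "j \<in> pverts (linked_cliques n) - S"
    using disj by (auto simp: linked_cliques_def)
  then obtain u where u: "u \<in> S" "(u, j) \<in> parcs (linked_cliques n)"
    using dom unfolding dominating_set_def by blast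
  moreover from u(1) have "u div n \<noteq> 0"
    using disj j by (auto simp: div_eq_0_iff)
  ultimately have "u mod n = j"
    using j by (auto simp: linked_cliques_def)
  with u(1) show "j \<in> (\<lambda>u. u mod n) ` S"
    by blast
qed

text \<open>A member in a clique dominates the rest of it, and \<open>B\<^sub>0\<close> is dominated
  either from inside or by members at all positions.\<close>

lemma dominating_linked_cliquesI:
  assumes S: "S \<subseteq> {..<n * Suc n}"
    and cols: "{1..n} \<subseteq> (\<lambda>u. u div n) ` S"
    and base: "S \<inter> {..<n} \<noteq> {} \<or> {..<n} \<subseteq> (\<lambda>u. u mod n) ` S"
  shows "dominating_set (linked_cliques n) S"
  unfolding dominating_set_def
proof (intro conjI ballI)
  show "S \<subseteq> pverts (linked_cliques n)"
    using S by (simp add: linked_cliques_def)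
  fix v assume "v \<in> pverts (linked_cliques n) - S"
  then have v: "v < n * Suc n" "v \<notin> S"
    by (auto simp: linked_cliques_def)
  have "\<exists>u \<in> S. u div n = v div n \<or> u mod n = v mod n \<and> v div n = 0"
  proof (cases "v div n = 0")
    case True
    then have "v < n"
      using v(1) by (cases "n = 0") (auto simp: div_eq_0_iff)
    from base show ?thesis
    proof
      assume "S \<inter> {..<n} \<noteq> {}"
      then obtain u where "u \<in> S" "u < n"
        by blast
      then show ?thesis
        using True by (intro bexI[of _ u]) simp_all
    next
      assume "{..<n} \<subseteq> (\<lambda>u. u mod n) ` S"
      then obtain u where "u \<in> S" "v = u mod n"
        using \<open>v < n\<close> by blast
      then show ?thesis
        using True by (intro bexI[of _ u]) simp_all
    qed
  next
    case False
    then have "v div n \<in> {1..n}"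
      using div_le_if_less_mult_Suc[OF v(1)] by simp
    with cols obtain u where "u \<in> S" "v div n = u div n"
      by blast
    then show ?thesis
      by metis
  qed
  then obtain u where "u \<in> S" "u div n = v div n \<or> u mod n = v mod n \<and> v div n = 0"
    by blast
  moreover from this have "u < n * Suc n" "u \<noteq> v"
    using v S by auto
  ultimately show "\<exists>u \<in> S. (u, v) \<in> parcs (linked_cliques n)"
    using v by (intro bexI[of _ u]) (auto simp: linked_cliques_def)
qed

lemma dominating_base_clique: "dominating_set (linked_cliques n) {..<n}"
  unfolding dominating_set_def
proof (intro conjI ballI)
  show "{..<n} \<subseteq> pverts (linked_cliques n)"
    by (auto simp: linked_cliques_def)
  fix v assume v: "v \<in> pverts (linked_cliques n) - {..<n}"
  then have "n > 0"
    by (cases n) (auto simp: linked_cliques_def)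
  then have "v mod n < n"
    by simp
  with v have "(v mod n, v) \<in> parcs (linked_cliques n)"
    by (auto simp: linked_cliques_def)
  then show "\<exists>u \<in> {..<n}. (u, v) \<in> parcs (linked_cliques n)"
    using \<open>v mod n < n\<close> by blast
qed

text \<open>A proper subset of \<open>B\<^sub>0\<close> neither contains \<open>B\<^sub>0\<close>
  nor meets \<open>B\<^sub>1\<close>.\<close>

lemma minimal_dominating_base_clique:
  assumes "n > 0"
  shows "minimal_dominating_set (linked_cliques n) {..<n}"
  unfolding minimal_dominating_set_def
proof (intro conjI allI impI notI dominating_base_clique)
  fix T assume T: "T \<subset> {..<n}" "dominating_set (linked_cliques n) T"
  then have "1 \<notin> (\<lambda>u. u div n) ` T"
    by auto
  then have "\<not> {1..n} \<subseteq> (\<lambda>u. u div n) ` T"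
    using assms by (auto dest: subsetD[of _ _ 1])
  with dominating_linked_cliques_cases[OF T(2)] T(1) show False
    by blast
qed

section \<open>Sizes of minimal dominating sets\<close>

text \<open>View \<open>x\<close> as an edge joining \<open>f x\<close> to \<open>g x\<close>: each
  edge has an end that no other edge uses, as in a minimal edge cover. \<open>P\<close> collects the
  edges alone at their \<open>f\<close>-end, \<open>Q\<close> the rest, alone at their
  \<open>g\<close>-end. If both are nonempty, each injects into its side with one value left out;
  otherwise \<open>S\<close> injects into one side.\<close>

lemma card_le_if_fibres_singleton:
  assumes fin: "finite A" "finite B" and sub: "f ` S \<subseteq> A" "g ` S \<subseteq> B"
    and single: "\<And>x. x \<in> S \<Longrightarrow>
      (\<forall>y \<in> S. f y = f x \<longrightarrow> y = x) \<or> (\<forall>y \<in> S. g y = g x \<longrightarrow> y = x)"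
  shows "card S \<le> max (max (card A) (card B)) (card A + card B - 2)"
proof -
  define P where "P = {x \<in> S. \<forall>y \<in> S. f y = f x \<longrightarrow> y = x}"
  define Q where "Q = S - P"
  have S: "S = P \<union> Q"
    by (auto simp: P_def Q_def)
  have P: "y = x" if "x \<in> P" "y \<in> S" "f y = f x" for x y
    using that by (simp add: P_def)
  have Q: "y = x" if "x \<in> Q" "y \<in> S" "g y = g x" for x y
  proof -
    from that(1) have "x \<in> S" "\<not> (\<forall>y \<in> S. f y = f x \<longrightarrow> y = x)"
      by (simp_all add: P_def Q_def)
    with single[of x] that(2,3) show ?thesis
      by blast
  qed
  have inj_f: "inj_on f P" and inj_g: "inj_on g Q"
    using P Q S by (auto intro!: inj_onI)
  have le: "card P \<le> card A'" if "f ` P \<subseteq> A'" "finite A'" for A'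
    using card_inj_on_le[OF inj_f that] .
  have le': "card Q \<le> card B'" if "g ` Q \<subseteq> B'" "finite B'" for B'
    using card_inj_on_le[OF inj_g that] .
  consider "P = {}" | "Q = {}" | p q where "p \<in> P" "q \<in> Q"
    by blast
  then show ?thesis
  proof cases
    case 1
    then show ?thesis
      using le'[of B] sub fin S by auto
  next
    case 2
    then show ?thesis
      using le[of A] sub fin S by auto
  next
    case 3
    then have in_S: "p \<in> S" "q \<in> S"
      using S by auto
    have "f x \<noteq> f q" if "x \<in> P" for x
    proof
      assume "f x = f q"
      then have "q = x"
        using P[OF that in_S(2)] by simp
      with that 3(2) show False
        by (simp add: Q_def)
    qed
    then have "f ` P \<subseteq> A - {f q}"
      using sub(1) S by (simp add: image_subset_iff)
    moreover have "f q \<in> A"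
      using sub(1) in_S(2) by (rule subsetD[OF _ imageI])
    \<comment> \<open>Subtraction is truncated, so positivity is what lets the two decrements merge
      into \<open>- 2\<close>.\<close>
    ultimately have "card P \<le> card A - 1" "card A > 0"
      using le[of "A - {f q}"] fin(1) by (simp_all add: card_gt_0_iff) blast
    have "g x \<noteq> g p" if "x \<in> Q" for x
    proof
      assume "g x = g p"
      then have "p = x"
        using Q[OF that in_S(1)] by simp
      with that 3(1) show False
        by (simp add: Q_def)
    qed
    then have "g ` Q \<subseteq> B - {g p}"
      using sub(2) S by (simp add: image_subset_iff)
    moreover have "g p \<in> B"
      using sub(2) in_S(1) by (rule subsetD[OF _ imageI])
    ultimately have "card Q \<le> card B - 1" "card B > 0"
      using le'[of "B - {g p}"] fin(2) by (simp_all add: card_gt_0_iff) blast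
    with \<open>card P \<le> card A - 1\<close> \<open>card A > 0\<close> show ?thesis
      using card_Un_le[of P Q] S by simp
  qed
qed

lemma image_subset_image_remove:
  assumes "y \<in> S" "y \<noteq> x" "f y = f x"
  shows "f ` S \<subseteq> f ` (S - {x})"
proof
  fix v assume "v \<in> f ` S"
  then obtain u where "u \<in> S" "v = f u"
    by blast
  then show "v \<in> f ` (S - {x})"
    using assms by (cases "u = x") (auto intro: image_eqI[of _ _ y])
qed

lemma card_minimal_dominating_linked_cliques:
  assumes n: "n \<ge> 3" and min: "minimal_dominating_set (linked_cliques n) S"
  shows "card S \<le> 2 * n - 2"
proof -
  have dom: "dominating_set (linked_cliques n) S"
    and eqI: "\<And>T. T \<subseteq> S \<Longrightarrow> dominating_set (linked_cliques n) T \<Longrightarrow> T = S"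
    using min by (auto simp: minimal_dominating_set_def)
  have sub: "S \<subseteq> {..<n * Suc n}"
    using dom by (simp add: dominating_set_def linked_cliques_def)
  \<comment> \<open>The second inequality says exactly \<open>n \<ge> 3\<close>;
    \<open>Suc n\<close> bounds the sets that meet \<open>B\<^sub>0\<close> without containing
    it.\<close>
  have len: "n \<le> 2 * n - 2" "Suc n \<le> 2 * n - 2"
    using n by auto
  show ?thesis
  proof (cases "{..<n} \<subseteq> S")
    case True
    then have "S = {..<n}"
      using eqI[OF _ dominating_base_clique] by simp
    then show ?thesis
      using len by simp
  next
    case False
    then have cols: "{1..n} \<subseteq> (\<lambda>u. u div n) ` S"
      using dominating_linked_cliques_cases[OF dom] by blast
    show ?thesis
    proof (cases "S \<inter> {..<n} = {}")
      case False
      then obtain b where b: "b \<in> S" "b < n"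
        by auto
      \<comment> \<open>One vertex from each of the other cliques suffices once \<open>b\<close>
        dominates \<open>B\<^sub>0\<close>, so minimality leaves nothing else in
        \<open>S\<close>.\<close>
      obtain T where T: "T \<subseteq> S" "inj_on (\<lambda>u. u div n) T" "{1..n} = (\<lambda>u. u div n) ` T"
        using subset_image_inj[of "{1..n}" "\<lambda>u. u div n" S] cols by auto
      have "dominating_set (linked_cliques n) (insert b T)"
      proof (rule dominating_linked_cliquesI)
        show "insert b T \<subseteq> {..<n * Suc n}"
          using T(1) b sub by blast
        show "{1..n} \<subseteq> (\<lambda>u. u div n) ` insert b T"
          unfolding T(3) by blast
      qed (use b in blast)
      then have "S = insert b T"
        using eqI[of "insert b T"] T b by auto
      moreover have "card T = n"
        using card_image[OF T(2)] T(3) by (metis card_atLeastAtMost diff_Suc_1)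
      ultimately show ?thesis
        using len card_insert_le_m1[of "Suc n" T b] by simp
    next
      case True
      note rows = dominating_linked_cliques_rows[OF dom True]
      \<comment> \<open>With \<open>B\<^sub>0\<close> avoided, a vertex is an edge of the complete
        bipartite graph between cliques \<open>{1..n}\<close> and positions
        \<open>{..<n}\<close>.\<close>
      have colsub: "(\<lambda>u. u div n) ` S \<subseteq> {1..n}"
      proof
        fix i assume "i \<in> (\<lambda>u. u div n) ` S"
        then obtain u where u: "u \<in> S" "i = u div n"
          by blast
        then have "\<not> u < n" "u < n * Suc n"
          using True sub by blast+
        then show "i \<in> {1..n}"
          unfolding u(2) atLeastAtMost_iff
          using n div_le_if_less_mult_Suc[of u n] div_greater_zero_iff[of u n] by linarith
      qed
      have rowsub: "(\<lambda>u. u mod n) ` S \<subseteq> {..<n}"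
        using n by auto
      have "card S \<le> max (max (card {1..n}) (card {..<n})) (card {1..n} + card {..<n} - 2)"
      proof (rule card_le_if_fibres_singleton[OF _ _ colsub rowsub])
        fix x assume x: "x \<in> S"
        show "(\<forall>y\<in>S. y div n = x div n \<longrightarrow> y = x) \<or> (\<forall>y\<in>S. y mod n = x mod n \<longrightarrow> y = x)"
        proof (rule ccontr)
          assume "\<not> ?thesis"
          then obtain y z where yz: "y \<in> S" "y \<noteq> x" "y div n = x div n"
            "z \<in> S" "z \<noteq> x" "z mod n = x mod n"
            by blast
          \<comment> \<open>Here \<open>y\<close> replaces \<open>x\<close> in its clique and
            \<open>z\<close> at its position, so deleting \<open>x\<close> contradicts
            minimality.\<close>
          have "{1..n} \<subseteq> (\<lambda>u. u div n) ` (S - {x})"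
            by (rule order.trans[OF cols image_subset_image_remove[OF yz(1,2)]]) (rule yz(3))
          moreover have "{..<n} \<subseteq> (\<lambda>u. u mod n) ` (S - {x})"
            by (rule order.trans[OF rows image_subset_image_remove[OF yz(4,5)]]) (rule yz(6))
          moreover have "S - {x} \<subseteq> {..<n * Suc n}"
            using sub by blast
          ultimately have "dominating_set (linked_cliques n) (S - {x})"
            by (intro dominating_linked_cliquesI disjI2)
          then have "S - {x} = S"
            by (intro eqI) auto
          with x show False
            by blast
        qed
      qed auto
      then show ?thesis
        using len by simp
    qed
  qed
qed

text \<open>Together the bounds put the successor of this number strictly between \<open>n\<close>
  and \<open>2 * n\<close>.\<close>

lemma upper_domination_number_linked_cliques:
  assumes "n \<ge> 3"
  shows "n \<le> upper_domination_number (linked_cliques n)"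
    and "upper_domination_number (linked_cliques n) \<le> 2 * n - 2"
proof -
  let ?M = "{S. minimal_dominating_set (linked_cliques n) S}"
  have fin: "finite ?M"
    by (rule finite_minimal_dominating_sets) (simp add: linked_cliques_def)
  have base: "{..<n} \<in> ?M"
    using minimal_dominating_base_clique assms by simp
  have "card {..<n} \<in> card ` ?M"
    using base by (rule imageI)
  with fin have "card {..<n} \<le> upper_domination_number (linked_cliques n)"
    unfolding upper_domination_number_def by (intro Max_ge finite_imageI)
  then show "n \<le> upper_domination_number (linked_cliques n)"
    by simp
  show "upper_domination_number (linked_cliques n) \<le> 2 * n - 2"
    unfolding upper_domination_number_def
  proof (rule Max.boundedI)
    show "finite (card ` ?M)"
      using fin by (rule finite_imageI)
    show "card ` ?M \<noteq> {}"
      using base by blast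
    show "k \<le> 2 * n - 2" if "k \<in> card ` ?M" for k
      using that card_minimal_dominating_linked_cliques[OF assms] by blast
  qed
qed

section \<open>Disconnectedness of the dominating graph\<close>

text \<open>If \<open>T\<close> fails to contain \<open>B\<^sub>0\<close>, it arises from
  \<open>S\<close> by deleting one vertex of \<open>B\<^sub>0\<close>, and it meets every other
  clique. Then \<open>S\<close> has \<open>n\<close> vertices outside \<open>B\<^sub>0\<close>
  besides all of \<open>B\<^sub>0\<close>, too many for \<open>card S < 2 * n\<close>.\<close>

lemma base_clique_subset_if_adjacent:
  assumes dom: "dominating_set (linked_cliques n) T"
    and fin: "finite S" and card: "card S < 2 * n"
    and base: "{..<n} \<subseteq> S" and diff: "card ((S - T) \<union> (T - S)) = 1"
  shows "{..<n} \<subseteq> T"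
proof (rule ccontr)
  assume not_base: "\<not> {..<n} \<subseteq> T"
  then have cols: "{1..n} \<subseteq> (\<lambda>u. u div n) ` T"
    using dominating_linked_cliques_cases[OF dom] by blast
  obtain d where d: "(S - T) \<union> (T - S) = {d}"
    using diff by (rule card_1_singletonE)
  moreover obtain b where "b < n" "b \<notin> T"
    using not_base by blast
  ultimately have "b \<in> S" "b = d"
    using base by blast+
  with d have "T \<subseteq> S"
    by blast
  have "{1..n} \<subseteq> (\<lambda>u. u div n) ` (S - {..<n})"
  proof
    fix i assume i: "i \<in> {1..n}"
    then obtain u where u: "u \<in> T" "i = u div n"
      using cols by blast
    with i have "\<not> u < n"
      by auto
    with u \<open>T \<subseteq> S\<close> show "i \<in> (\<lambda>u. u div n) ` (S - {..<n})"
      by blast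
  qed
  then have "card {1..n} \<le> card (S - {..<n})"
    using fin by (intro surj_card_le) auto
  moreover have "card (S - {..<n}) = card S - n"
    using card_Diff_subset[of "{..<n}" S] base by simp
  ultimately show False
    using card by simp
qed

text \<open>Connectedness of a digraph refers to its symmetric closure, hence the equivalence along
  arcs instead of preservation in one direction.\<close>

lemma not_connected_if_closed:
  assumes "u \<in> pverts D" "v \<in> pverts D" "P u" "\<not> P v"
    and closed: "\<And>x y. (x, y) \<in> parcs D \<Longrightarrow> P x \<longleftrightarrow> P y"
  shows "\<not> Digraph_Component.connected (with_proj D)"
proof
  assume "Digraph_Component.connected (with_proj D)"
  then have "u \<rightarrow>\<^sup>*\<^bsub>with_proj (mk_symmetric (with_proj D))\<^esub> v"
    using assms(1,2) by (auto simp: Digraph_Component.connected_def strongly_connected_def)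
  then have "(u, v) \<in> (parcs (mk_symmetric (with_proj D)))\<^sup>*"
    using reachable_rtranclI by fastforce
  then have "P v"
    by (induction rule: rtrancl_induct) (use \<open>P u\<close> closed in \<open>auto simp: parcs_mk_symmetric\<close>)
  with \<open>\<not> P v\<close> show False ..
qed

lemma not_connected_dominating_graph_linked_cliques:
  assumes n: "n \<ge> 3" and k: "n < k" "k < 2 * n"
  shows "\<not> Digraph_Component.connected (with_proj (dominating_graph k (linked_cliques n)))"
proof (rule not_connected_if_closed[where P = "\<lambda>S. {..<n} \<subseteq> S"])
  \<comment> \<open>The vertices at position 0 of all \<open>n + 1\<close> cliques;
    \<open>n < k\<close> leaves room for them.\<close>
  let ?T = "(\<lambda>i. i * n) ` {..n}"
  show "{..<n} \<in> pverts (dominating_graph k (linked_cliques n))"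
    using dominating_base_clique k by (simp add: dominating_graph_def Let_def)
  have "dominating_set (linked_cliques n) ?T"
  proof (rule dominating_linked_cliquesI)
    show "?T \<subseteq> {..<n * Suc n}"
      using n mult_add_less_mult_Suc[of _ n 0] by auto
    show "{1..n} \<subseteq> (\<lambda>u. u div n) ` ?T"
      using n by (auto simp: image_image)
    have "0 \<in> ?T \<inter> {..<n}"
      using n by force
    then show "?T \<inter> {..<n} \<noteq> {} \<or> {..<n} \<subseteq> (\<lambda>u. u mod n) ` ?T"
      by blast
  qed
  moreover have "card ?T \<le> k"
    using card_image_le[of "{..n}" "\<lambda>i. i * n"] k by simp
  ultimately show "?T \<in> pverts (dominating_graph k (linked_cliques n))"
    by (simp add: dominating_graph_def Let_def)
  have "1 \<notin> ?T"
    using n by auto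
  then show "\<not> {..<n} \<subseteq> ?T"
    using n by (meson lessThan_iff less_le_trans one_less_numeral_iff semiring_norm(77) subsetD)
next
  fix S T assume "(S, T) \<in> parcs (dominating_graph k (linked_cliques n))"
  \<comment> \<open>The symmetric difference is recorded in both orders, so that the closure
    argument applies from \<open>S\<close> to \<open>T\<close> and back.\<close>
  then have ST: "dominating_set (linked_cliques n) S" "dominating_set (linked_cliques n) T"
    "card S < 2 * n" "card T < 2 * n" "card ((S - T) \<union> (T - S)) = 1"
    "card ((T - S) \<union> (S - T)) = 1"
    using k by (auto simp: dominating_graph_def Let_def Un_commute)
  moreover have "finite S" "finite T"
    using ST(1,2) by (auto simp: dominating_set_def linked_cliques_def intro: finite_subset)
  ultimately show "{..<n} \<subseteq> S \<longleftrightarrow> {..<n} \<subseteq> T"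
    using base_clique_subset_if_adjacent by metis
qed simp

section \<open>The infinite family\<close>

theorem theorem3:
  shows "\<exists>F :: nat pair_pre_digraph set.
    infinite F \<and>
    (\<forall>G \<in> F. \<forall>H \<in> F. digraph_iso (with_proj G) (with_proj H) \<longrightarrow> G = H) \<and>
    (\<forall>G \<in> F. pair_graph G) \<and>
    (\<forall>G \<in> F. \<not> Digraph_Component.connected
      (with_proj (dominating_graph (upper_domination_number G + 1) G)))"
proof (intro exI conjI ballI impI)
  let ?F = "linked_cliques ` {3..}"
  \<comment> \<open>The order \<open>n * Suc n\<close> determines \<open>n\<close>; this gives both
    the infinitude of the family and the equality of isomorphic members.\<close>
  have eq_if_card: "m = n" if "card (pverts (linked_cliques m)) = card (pverts (linked_cliques n))" for m n
    using that strict_mono_eq[OF strict_mono_mult_Suc] unfolding card_verts_linked_cliques by simp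
  then have "inj_on linked_cliques {3..}"
    by (intro inj_onI) simp
  then show "infinite ?F"
    using infinite_Ici[of "3::nat"] finite_imageD by blast
  show "G = H" if "G \<in> ?F" "H \<in> ?F" "digraph_iso (with_proj G) (with_proj H)" for G H
  proof -
    from that(1,2) obtain m n where "G = linked_cliques m" "H = linked_cliques n"
      by blast
    then show ?thesis
      using eq_if_card[of m n] digraph_iso_card_verts[OF that(3)] by simp
  qed
  show "pair_graph G" if "G \<in> ?F" for G
    using that pair_graph_linked_cliques by auto
  fix G assume "G \<in> ?F"
  then obtain n where n: "n \<ge> 3" "G = linked_cliques n"
    by auto
  show "\<not> Digraph_Component.connected
      (with_proj (dominating_graph (upper_domination_number G + 1) G))"
    unfolding n(2)
    using upper_domination_number_linked_cliques[OF n(1)] n(1)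
    by (intro not_connected_dominating_graph_linked_cliques) linarith+
qed

end
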